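(* For every integer $n\ge 1$, $$\gamma_{rdR}(K_n\odot K_1)=\begin{cases}2n+1, & n\ne 2,\\ 6, & n=2.\end{cases}$$
   Context: Graphs are finite and simple. A restrained double Roman dominating function (RDRD-function) of a graph $G$ is a function $f:V(G)\to\{0,1,2,3\}$ such that: (i) if $f(v)=0$, then $v$ has at least two neighbours assigned 2 under $f$ or at least one neighbour assigned 3; (ii) if $f(v)=1$, then $v$ has a neighbour $u$ with $f(u)\ge 2$; (iii) the subgraph of $G$ induced by the vertices assigned 0 contains no isolated vertex. The weight of $f$ is $\sum_{v\in V(G)}f(v)$, and $\gamma_{rdR}(G)$ is the minimum weight of an RDRD-function of $G$. $K_n$ is the complete graph on $n$ vertices. The corona $G\odot K_1$ is the graph obtained from $G$ by adding, for each vertex $v\in V(G)$, a new leaf $v'$ adjacent only to $v$. *)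

theory Defs
  imports "Graph_Theory.Graph_Theory"
begin

text \<open>
  Finite simple graphs are the symmetric, loop-free digraphs without parallel arcs of locale
  \<^locale>\<open>graph\<close>; an edge is a pair of opposite arcs. The definitions below are
  intended for such graphs only.
\<close>

definition neighbours :: "('a, 'b) pre_digraph \<Rightarrow> 'a \<Rightarrow> 'a set" where
  "neighbours G v = {u. v \<rightarrow>\<^bsub>G\<^esub> u}"

definition isolated :: "('a, 'b) pre_digraph \<Rightarrow> 'a \<Rightarrow> bool" where
  "isolated G v \<longleftrightarrow> v \<in> verts G \<and> neighbours G v = {}"

text \<open>
  A function on the vertices is a total function on the vertex type; its values outside
  \<^term>\<open>verts G\<close> affect neither the conditions nor the weight.
\<close>

definition RDRD_function :: "('a, 'b) pre_digraph \<Rightarrow> ('a \<Rightarrow> nat) \<Rightarrow> bool" where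
  "RDRD_function G f \<longleftrightarrow>
     f ` verts G \<subseteq> {0, 1, 2, 3} \<and>
     (\<forall>v \<in> verts G. f v = 0 \<longrightarrow>
        card {u \<in> neighbours G v. f u = 2} \<ge> 2 \<or> (\<exists>u \<in> neighbours G v. f u = 3)) \<and>
     (\<forall>v \<in> verts G. f v = 1 \<longrightarrow> (\<exists>u \<in> neighbours G v. f u \<ge> 2)) \<and>
     (\<nexists>v. isolated (G \<restriction> {v \<in> verts G. f v = 0}) v)"

definition weight :: "('a, 'b) pre_digraph \<Rightarrow> ('a \<Rightarrow> nat) \<Rightarrow> nat" where
  "weight G f = (\<Sum>v \<in> verts G. f v)"

definition gamma_rdR :: "('a, 'b) pre_digraph \<Rightarrow> nat" where
  "gamma_rdR G = (LEAST w. \<exists>f. RDRD_function G f \<and> weight G f = w)"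

text \<open>The minimum is over a nonempty set: the constant function 2 always qualifies.\<close>

lemma RDRD_function_const_2: "RDRD_function G (\<lambda>_. 2)"
  by (auto simp: RDRD_function_def isolated_def)

text \<open>
  The corona with \<open>K\<^sub>1\<close>: \<^term>\<open>Inl v\<close> is the original vertex \<open>v\<close>, and
  \<^term>\<open>Inr v\<close> is its new leaf.
\<close>

definition corona_K1 :: "('a, 'b) pre_digraph \<Rightarrow> ('a + 'a, ('a + 'a) \<times> ('a + 'a)) pre_digraph" where
  "corona_K1 G = with_proj
     \<lparr> pverts = Inl ` verts G \<union> Inr ` verts G,
       parcs = {(Inl u, Inl v) | u v. u \<rightarrow>\<^bsub>G\<^esub> v}
             \<union> {(Inl v, Inr v) | v. v \<in> verts G}
             \<union> {(Inr v, Inl v) | v. v \<in> verts G} \<rparr>"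

lemma graph_corona_K1:
  assumes "graph G"
  shows "graph (corona_K1 G)"
proof -
  interpret graph G by fact
  let ?V = "Inl ` verts G \<union> Inr ` verts G :: ('a + 'a) set"
  let ?A = "{(Inl u, Inl v) | u v. u \<rightarrow>\<^bsub>G\<^esub> v} \<union> {(Inl v, Inr v) | v. v \<in> verts G}
             \<union> {(Inr v, Inl v) | v. v \<in> verts G} :: ('a + 'a) rel"
  have sub: "?A \<subseteq> ?V \<times> ?V"
    by (auto dest: adj_in_verts)
  have "finite ?A"
    by (rule finite_subset[OF sub]) simp
  moreover have "sym ?A"
    using arcs_ends_symmetric[OF sym_arcs] by (auto simp: sym_def)
  moreover have "fst e \<noteq> snd e" if "e \<in> ?A" for e
    using that adj_not_same by auto
  ultimately have "pair_graph \<lparr> pverts = ?V, parcs = ?A \<rparr>"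
    using sub by unfold_locales (auto simp: symmetric_def)
  then show ?thesis
    unfolding corona_K1_def by (rule pair_graph.pair_graphD_graph)
qed

end

theory Submission
  imports Defs
begin

text \<open>
  In a corona, split the weight into the contributions of the pairs consisting of a vertex \<open>v\<close>
  and its leaf. Since a leaf has a single neighbour, it cannot have value 0: it would need a
  neighbour of value 3 and also a neighbour of value 0. If it has value 1, its pair weighs at
  least 3. Hence every pair weighs at least 2, with equality only for the values 0 on \<open>v\<close> and 2
  on its leaf (\<open>leaf_pair\<close>). In that case the leaf supplies only one of the two neighbours of
  value 2 that \<open>v\<close> needs, so \<open>v\<close> has a neighbour of value at least 2 in \<open>G\<close>; and it has a
  neighbour of value 0, which is again in \<open>G\<close> (\<open>light_pair\<close>).

  The first of these neighbours belongs to a pair of weight at least 3, so the total weight is at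
  least \<open>2n + 1\<close> for every nonempty \<open>G\<close>. The two together show that a vertex whose pair weighs 2
  has degree at least 2 in \<open>G\<close>; in \<open>K\<^sub>2\<close> there is none, and both pairs weigh at least 3.

  Conversely, let \<open>C\<close> be a restrained dominating set of \<open>G\<close>: every vertex outside \<open>C\<close> has a
  neighbour in \<open>C\<close> and one outside \<open>C\<close>. Pairs of values \<open>(2, 1)\<close> on \<open>C\<close> and \<open>(0, 2)\<close> elsewhere
  form an RDRD-function of weight \<open>2n + |C|\<close>. In \<open>K\<^sub>n\<close> with \<open>n \<noteq> 2\<close> a single vertex is a
  restrained dominating set, because outside it there are either no vertices or at least two; in
  \<open>K\<^sub>2\<close> the whole vertex set serves.
\<close>

lemma dominates_induce_subgraph_iff:
  "u \<rightarrow>\<^bsub>G \<restriction> S\<^esub> v \<longleftrightarrow> u \<rightarrow>\<^bsub>G\<^esub> v \<and> u \<in> S \<and> v \<in> S"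
  by (auto simp: arcs_ends_conv)

lemma isolated_induce_subgraph_iff:
  "isolated (G \<restriction> S) v \<longleftrightarrow> v \<in> S \<and> neighbours G v \<inter> S = {}"
  by (auto simp: isolated_def neighbours_def dominates_induce_subgraph_iff)

lemma verts_corona_K1: "verts (corona_K1 G) = Inl ` verts G \<union> Inr ` verts G"
  by (simp add: corona_K1_def)

lemma neighbours_corona_K1_Inl:
  assumes "v \<in> verts G"
  shows "neighbours (corona_K1 G) (Inl v) = insert (Inr v) (Inl ` neighbours G v)"
  using assms by (auto simp: neighbours_def corona_K1_def)

lemma neighbours_corona_K1_Inr:
  assumes "v \<in> verts G"
  shows "neighbours (corona_K1 G) (Inr v) = {Inl v}"
  using assms by (auto simp: neighbours_def corona_K1_def)

lemma weight_corona_K1: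
  assumes "finite (verts G)"
  shows "weight (corona_K1 G) f = (\<Sum>v \<in> verts G. f (Inl v) + f (Inr v))"
proof -
  have "weight (corona_K1 G) f
      = (\<Sum>x \<in> Inl ` verts G. f x) + (\<Sum>x \<in> Inr ` verts G. f x)"
    unfolding weight_def verts_corona_K1 using assms by (intro sum.union_disjoint) auto
  also have "\<dots> = (\<Sum>v \<in> verts G. f (Inl v)) + (\<Sum>v \<in> verts G. f (Inr v))"
    by (simp add: sum.reindex)
  finally show ?thesis
    by (simp add: sum.distrib)
qed

lemma RDRD_function_zero_neighbour:
  assumes "RDRD_function G f" "v \<in> verts G" "f v = 0"
  shows "\<exists>u \<in> neighbours G v. f u = 0"
  using assms by (auto simp: RDRD_function_def isolated_induce_subgraph_iff)

lemma RDRD_function_zero_cases: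
  assumes "RDRD_function G f" "v \<in> verts G" "f v = 0"
  shows "card {u \<in> neighbours G v. f u = 2} \<ge> 2 \<or> (\<exists>u \<in> neighbours G v. f u = 3)"
  using assms by (simp add: RDRD_function_def)

text \<open>
  The only neighbour of a leaf of value 0 would need the value 0, to keep the leaf from being
  isolated among the zeros, but also a positive value, to dominate the leaf.
\<close>

lemma leaf_pos:
  assumes "RDRD_function (corona_K1 G) f" "v \<in> verts G"
  shows "f (Inr v) \<ge> 1"
proof (rule ccontr)
  assume "\<not> ?thesis"
  then have zero: "f (Inr v) = 0" by simp
  have V: "Inr v \<in> verts (corona_K1 G)"
    using assms(2) by (simp add: verts_corona_K1)
  have "f (Inl v) = 0"
    using RDRD_function_zero_neighbour[OF assms(1) V zero]
    by (simp add: neighbours_corona_K1_Inr[OF assms(2)])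
  then have "{u \<in> neighbours (corona_K1 G) (Inr v). f u = 2} = {}"
    and "\<not> (\<exists>u \<in> neighbours (corona_K1 G) (Inr v). f u = 3)"
    by (auto simp: neighbours_corona_K1_Inr[OF assms(2)])
  with RDRD_function_zero_cases[OF assms(1) V zero] show False
    by simp
qed

lemma leaf_pair:
  assumes "RDRD_function (corona_K1 G) f" "v \<in> verts G"
  shows "f (Inl v) + f (Inr v) \<ge> 3 \<or> f (Inl v) = 0 \<and> f (Inr v) = 2"
proof (cases "f (Inr v) = 1")
  case True
  then have "f (Inl v) \<ge> 2"
    using assms
    by (auto simp: RDRD_function_def verts_corona_K1 neighbours_corona_K1_Inr)
  with True show ?thesis by simp
next
  case False
  with leaf_pos[OF assms] show ?thesis by linarith
qed

text \<open>
  By \<open>leaf_pair\<close> the values are 0 on \<open>v\<close> and 2 on its leaf. So the leaf alone does not dominate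
  \<open>v\<close>, nor does it serve as the neighbour of value 0: \<open>v\<close> must find help for both in \<open>G\<close>.
\<close>

lemma light_pair:
  assumes f: "RDRD_function (corona_K1 G) f" and v: "v \<in> verts G"
    and light: "f (Inl v) + f (Inr v) < 3"
  shows "\<exists>u \<in> neighbours G v. f (Inl u) \<ge> 2" and "\<exists>w \<in> neighbours G v. f (Inl w) = 0"
proof -
  have vals: "f (Inl v) = 0" "f (Inr v) = 2"
    using leaf_pair[OF f v] light by auto
  have V: "Inl v \<in> verts (corona_K1 G)"
    using v by (simp add: verts_corona_K1)
  note nb = neighbours_corona_K1_Inl[OF v]
  show "\<exists>w \<in> neighbours G v. f (Inl w) = 0"
    using RDRD_function_zero_neighbour[OF f V vals(1)] vals by (auto simp: nb)
  show "\<exists>u \<in> neighbours G v. f (Inl u) \<ge> 2"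
  proof (rule ccontr)
    assume "\<not> ?thesis"
    then have small: "f (Inl u) < 2" if "u \<in> neighbours G v" for u
      using that by (meson not_less)
    then have "{x \<in> neighbours (corona_K1 G) (Inl v). f x = 2} = {Inr v}"
      and "\<not> (\<exists>x \<in> neighbours (corona_K1 G) (Inl v). f x = 3)"
      using vals by (fastforce simp: nb)+
    with RDRD_function_zero_cases[OF f V vals(1)] show False by simp
  qed
qed

text \<open>
  The extra unit comes from any pair of weight at least 3. If the pair of \<open>v\<close> is not one, then the
  neighbour of \<open>v\<close> with value at least 2 belongs to one, since its leaf has a positive value.
\<close>

lemma weight_corona_K1_ge:
  assumes "wf_digraph G" "finite (verts G)" "verts G \<noteq> {}" and f: "RDRD_function (corona_K1 G) f"
  shows "weight (corona_K1 G) f \<ge> 2 * card (verts G) + 1"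
proof -
  have two: "f (Inl v) + f (Inr v) \<ge> 2" if "v \<in> verts G" for v
    using leaf_pair[OF f that] by auto
  obtain u where u: "u \<in> verts G" "f (Inl u) + f (Inr u) \<ge> 3"
  proof -
    obtain v where v: "v \<in> verts G" using assms(3) by blast
    show ?thesis
    proof (cases "f (Inl v) + f (Inr v) < 3")
      case True
      then obtain u where "v \<rightarrow>\<^bsub>G\<^esub> u" and "f (Inl u) \<ge> 2"
        using light_pair(1)[OF f v] by (auto simp: neighbours_def)
      moreover from this have "u \<in> verts G"
        using wf_digraph.adj_in_verts(2)[OF assms(1)] by blast
      ultimately show ?thesis
        using that leaf_pos[OF f] by force
    qed (use v that in auto)
  qed
  have "(\<Sum>v \<in> verts G. 2) < (\<Sum>v \<in> verts G. f (Inl v) + f (Inr v))"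
    using u two assms(2) by (intro sum_strict_mono_ex1) force+
  then show ?thesis
    by (simp add: weight_corona_K1[OF assms(2)])
qed

text \<open>
  A pair of weight below 3 would give \<open>v\<close> two distinct neighbours in \<open>G\<close>, as the two neighbours
  found in \<open>light_pair\<close> have different values.
\<close>

lemma weight_corona_K1_ge_max_degree_1:
  assumes "finite (verts G)" and f: "RDRD_function (corona_K1 G) f"
    and deg: "\<And>v u w. v \<in> verts G \<Longrightarrow> u \<in> neighbours G v \<Longrightarrow> w \<in> neighbours G v \<Longrightarrow> u = w"
  shows "weight (corona_K1 G) f \<ge> 3 * card (verts G)"
proof -
  have "f (Inl v) + f (Inr v) \<ge> 3" if v: "v \<in> verts G" for v
  proof (rule ccontr)
    assume "\<not> ?thesis"
    then have "f (Inl v) + f (Inr v) < 3" by simp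
    from light_pair[OF f v this] deg[OF v] show False by fastforce
  qed
  then have "(\<Sum>v \<in> verts G. 3) \<le> (\<Sum>v \<in> verts G. f (Inl v) + f (Inr v))"
    by (rule sum_mono)
  then show ?thesis
    by (simp add: weight_corona_K1[OF assms(1)])
qed

text \<open>
  The hypothesis on \<open>C\<close> says that it is a restrained dominating set. A vertex outside \<open>C\<close> gets
  the value 0; it has a second neighbour of value 2 besides its leaf because \<open>C\<close> is dominating,
  and a neighbour of value 0 because \<open>C\<close> is restrained.
\<close>

lemma ex_RDRD_function_corona_K1:
  assumes "wf_digraph G" "finite (verts G)" and C: "C \<subseteq> verts G"
    and restrained: "\<And>v. v \<in> verts G - C \<Longrightarrow>
      (\<exists>u \<in> neighbours G v. u \<in> C) \<and> (\<exists>w \<in> neighbours G v. w \<notin> C)"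
  shows "\<exists>f. RDRD_function (corona_K1 G) f
    \<and> weight (corona_K1 G) f = 2 * card (verts G) + card C"
proof -
  define f :: "'a + 'a \<Rightarrow> nat" where
    "f = case_sum (\<lambda>v. if v \<in> C then 2 else 0) (\<lambda>v. if v \<in> C then 1 else 2)"
  have zero: "x \<in> Inl ` (verts G - C)" if "x \<in> verts (corona_K1 G)" "f x = 0" for x
    using that by (auto simp: f_def verts_corona_K1 split: if_splits)
  have "RDRD_function (corona_K1 G) f"
    unfolding RDRD_function_def
  proof (intro conjI ballI impI)
    show "f ` verts (corona_K1 G) \<subseteq> {0, 1, 2, 3}"
      by (auto simp: f_def verts_corona_K1 split: if_splits)
  next
    fix x assume "x \<in> verts (corona_K1 G)" "f x = 0"
    then obtain v where v: "x = Inl v" "v \<in> verts G - C"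
      using zero by blast
    then obtain u where u: "u \<in> neighbours G v" "u \<in> C"
      using restrained by blast
    let ?S = "{y \<in> neighbours (corona_K1 G) x. f y = 2}"
    have "neighbours G v \<subseteq> verts G"
      using wf_digraph.adj_in_verts(2)[OF assms(1)] by (auto simp: neighbours_def)
    then have "?S \<subseteq> verts (corona_K1 G)"
      using v by (auto simp: neighbours_corona_K1_Inl verts_corona_K1)
    then have "finite ?S"
      using assms(2) by (auto simp: verts_corona_K1 intro: finite_subset)
    moreover have "{Inr v, Inl u} \<subseteq> ?S"
      using u v by (auto simp: neighbours_corona_K1_Inl f_def)
    ultimately have "card {Inr v, Inl u} \<le> card ?S"
      by (rule card_mono)
    then show "2 \<le> card ?S \<or> (\<exists>y \<in> neighbours (corona_K1 G) x. f y = 3)"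
      by simp
  next
    fix x assume "x \<in> verts (corona_K1 G)" "f x = 1"
    then obtain v where "x = Inr v" "v \<in> C" "v \<in> verts G"
      by (auto simp: f_def verts_corona_K1 split: if_splits)
    then show "\<exists>y \<in> neighbours (corona_K1 G) x. f y \<ge> 2"
      by (simp add: neighbours_corona_K1_Inr f_def)
  next
    show "\<nexists>x. isolated (corona_K1 G \<restriction> {x \<in> verts (corona_K1 G). f x = 0}) x"
    proof
      assume "\<exists>x. isolated (corona_K1 G \<restriction> {x \<in> verts (corona_K1 G). f x = 0}) x"
      then obtain x where x: "x \<in> verts (corona_K1 G)" "f x = 0"
        and empty: "neighbours (corona_K1 G) x \<inter> {x \<in> verts (corona_K1 G). f x = 0} = {}"
        by (auto simp: isolated_induce_subgraph_iff)
      from x obtain v where v: "x = Inl v" "v \<in> verts G - C"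
        using zero by blast
      then obtain w where "w \<in> neighbours G v" "w \<notin> C"
        using restrained by blast
      moreover from this have "w \<in> verts G"
        using wf_digraph.adj_in_verts(2)[OF assms(1)] by (auto simp: neighbours_def)
      ultimately have "Inl w \<in> neighbours (corona_K1 G) x \<inter> {x \<in> verts (corona_K1 G). f x = 0}"
        using v by (simp add: neighbours_corona_K1_Inl verts_corona_K1 f_def)
      with empty show False by blast
    qed
  qed
  moreover have "weight (corona_K1 G) f = 2 * card (verts G) + card C"
  proof -
    have "weight (corona_K1 G) f = (\<Sum>v \<in> verts G. 2 + (if v \<in> C then 1 else 0))"
      unfolding weight_corona_K1[OF assms(2)] by (intro sum.cong) (auto simp: f_def)
    also have "\<dots> = 2 * card (verts G) + card (verts G \<inter> C)"
      using assms(2) by (simp only: sum.distrib) (simp add: sum.If_cases)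
    finally show ?thesis using C by (simp add: Int_absorb1)
  qed
  ultimately show ?thesis by blast
qed

lemma gamma_rdR_eqI:
  assumes "\<exists>f. RDRD_function G f \<and> weight G f = w"
    and "\<And>f. RDRD_function G f \<Longrightarrow> w \<le> weight G f"
  shows "gamma_rdR G = w"
  unfolding gamma_rdR_def by (rule Least_equality) (use assms in auto)

lemma neighbours_complete_digraph:
  assumes "complete_digraph n G" "v \<in> verts G"
  shows "neighbours G v = verts G - {v}"
  using assms by (auto simp: complete_digraph_def neighbours_def)

theorem theorem5p3:
  fixes G :: "('a, 'b) pre_digraph" and n :: nat
  assumes "n \<ge> 1" and "complete_digraph n G"
  shows "gamma_rdR (corona_K1 G) = (if n \<noteq> 2 then 2 * n + 1 else 6)"
proof -
  interpret graph G
    using assms(2) by (simp add: complete_digraph_def)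
  have card: "card (verts G) = n"
    using assms(2) by (simp add: complete_digraph_def)
  note nb = neighbours_complete_digraph[OF assms(2)]
  show ?thesis
  proof (cases "n = 2")
    case False
    obtain c where c: "c \<in> verts G"
      using card assms(1) by fastforce
    have "(\<exists>u \<in> neighbours G v. u \<in> {c}) \<and> (\<exists>w \<in> neighbours G v. w \<notin> {c})"
      if v: "v \<in> verts G - {c}" for v
    proof -
      have "card {c, v} \<noteq> card (verts G)"
        using v False card by auto
      then have "verts G \<noteq> {c, v}" by metis
      then obtain w where "w \<in> verts G - {c, v}"
        using c v by blast
      then show ?thesis using c v by (auto simp: nb)
    qed
    then have "\<exists>f. RDRD_function (corona_K1 G) f
        \<and> weight (corona_K1 G) f = 2 * card (verts G) + card {c}"
      using c by (intro ex_RDRD_function_corona_K1 wf_digraph_axioms) auto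
    moreover have "verts G \<noteq> {}" using c by blast
    ultimately have "gamma_rdR (corona_K1 G) = 2 * n + 1"
      using weight_corona_K1_ge[OF wf_digraph_axioms] card by (intro gamma_rdR_eqI) auto
    with False show ?thesis by simp
  next
    case True
    have deg: "u = w" if "v \<in> verts G" "u \<in> neighbours G v" "w \<in> neighbours G v" for v u w
    proof -
      have "card (neighbours G v) = 1"
        using that(1) card True by (simp add: nb)
      with that show ?thesis by (auto simp: card_1_singleton_iff)
    qed
    have "\<exists>f. RDRD_function (corona_K1 G) f
        \<and> weight (corona_K1 G) f = 2 * card (verts G) + card (verts G)"
      by (intro ex_RDRD_function_corona_K1 wf_digraph_axioms) auto
    moreover have "3 * card (verts G) \<le> weight (corona_K1 G) f"
      if "RDRD_function (corona_K1 G) f" for f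
      using that deg by (intro weight_corona_K1_ge_max_degree_1) auto
    ultimately have "gamma_rdR (corona_K1 G) = 6"
      using card True by (intro gamma_rdR_eqI) auto
    with True show ?thesis by simp
  qed
qed

end
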